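(* Let $\mathfrak{S}$ be the nonself-adjoint $2$-graph algebra generated by an isometric representation $(S,T)$ of a single vertex $2$-graph $\mathbb{F}_\theta^+$. If both $S$ and $T$ are singular, then $\mathfrak{S}$ is self-adjoint.
   Context: Single vertex $2$-graph: for positive integers $m,n$ (with $m>1$ or $n>1$) and a permutation $\theta$ of $\{1,\ldots,m\}\times\{1,\ldots,n\}$, $\mathbb{F}_\theta^+$ is the unital cancellative semigroup generated by $e_1,\ldots,e_m,f_1,\ldots,f_n$, where the $e_i$ generate a copy of the free semigroup $\mathbb{F}_m^+$, the $f_j$ generate a copy of $\mathbb{F}_n^+$, and $e_if_j=f_{j'}e_{i'}$ whenever $\theta(i,j)=(i',j')$. An isometric representation $(S,T)$ of $\mathbb{F}_\theta^+$ on a Hilbert space $\mathcal{H}$ consists of $S=[S_1,\ldots,S_m]$ and $T=[T_1,\ldots,T_n]$ with $S_i^*S_j=\delta_{i,j}I$, $T_k^*T_l=\delta_{k,l}I$, and $S_iT_j=T_{j'}S_{i'}$ whenever $\theta(i,j)=(i',j')$. The nonself-adjoint $2$-graph algebra $\mathfrak{S}$ generated by $(S,T)$ is the unital WOT-closed algebra generated by all $S_i,T_j$. A row-isometry $V=[V_1,\ldots,V_N]$ (isometries with $V_i^*V_j=\delta_{i,j}I$) is singular if the unital WOT-closed algebra generated by $V_1,\ldots,V_N$ (the free semigroup algebra it generates) is self-adjoint. *)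

theory Defs
  imports "HOL-Analysis.Analysis" "HOL-Combinatorics.Permutations"
begin

section \<open>Complex Hilbert spaces\<close>

text \<open>The inner product is linear in its first argument.\<close>

class complex_inner = real_normed_vector +
  fixes scaleC :: "complex \<Rightarrow> 'a \<Rightarrow> 'a"  (infixr "*\<^sub>C" 75)
    and cinner :: "'a \<Rightarrow> 'a \<Rightarrow> complex"
  assumes scaleC_add_right: "c *\<^sub>C (x + y) = c *\<^sub>C x + c *\<^sub>C y"
    and scaleC_add_left: "(c + d) *\<^sub>C x = c *\<^sub>C x + d *\<^sub>C x"
    and scaleC_scaleC: "c *\<^sub>C d *\<^sub>C x = (c * d) *\<^sub>C x"
    and scaleC_of_real: "complex_of_real r *\<^sub>C x = r *\<^sub>R x"
    and cinner_commute: "cinner x y = cnj (cinner y x)"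
    and cinner_add_left: "cinner (x + y) z = cinner x z + cinner y z"
    and cinner_scaleC_left: "cinner (c *\<^sub>C x) y = c * cinner x y"
    and cinner_self: "cinner x x = complex_of_real ((norm x)\<^sup>2)"

class chilbert_space = complex_inner + complete_space

instantiation complex :: chilbert_space
begin

definition scaleC_complex :: "complex \<Rightarrow> complex \<Rightarrow> complex"
  where "scaleC_complex c x = c * x"

definition cinner_complex :: "complex \<Rightarrow> complex \<Rightarrow> complex"
  where "cinner_complex x y = x * cnj y"

instance
proof
  fix c d x y z :: complex and r :: real
  show "c *\<^sub>C (x + y) = c *\<^sub>C x + c *\<^sub>C y" "(c + d) *\<^sub>C x = c *\<^sub>C x + d *\<^sub>C x"
    by (simp_all add: scaleC_complex_def distrib_left distrib_right)
  show "c *\<^sub>C d *\<^sub>C x = (c * d) *\<^sub>C x" "complex_of_real r *\<^sub>C x = r *\<^sub>R x"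
    by (simp_all add: scaleC_complex_def scaleR_conv_of_real)
  show "cinner x y = cnj (cinner y x)" "cinner (x + y) z = cinner x z + cinner y z"
      "cinner (c *\<^sub>C x) y = c * cinner x y"
    by (simp_all add: cinner_complex_def scaleC_complex_def distrib_right)
  show "cinner x x = complex_of_real ((norm x)\<^sup>2)"
    unfolding cinner_complex_def by (simp only: complex_norm_square)
qed

end

section \<open>Bounded operators and adjoints\<close>

definition bounded_clinear :: "('a::complex_inner \<Rightarrow> 'a) \<Rightarrow> bool"
  where "bounded_clinear A \<longleftrightarrow> bounded_linear A \<and> (\<forall>c x. A (c *\<^sub>C x) = c *\<^sub>C A x)"

text \<open>On a Hilbert space the adjoint of a bounded operator exists by the Riesz representation
  theorem; on other functions the value is unspecified.\<close>

definition cadjoint :: "('a::chilbert_space \<Rightarrow> 'a) \<Rightarrow> 'a \<Rightarrow> 'a"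
  where "cadjoint A =
    (THE B. bounded_clinear B \<and> (\<forall>x y. cinner (A x) y = cinner x (B y)))"

lemma cinner_ext:
  fixes u v :: "'a::complex_inner"
  assumes "\<And>x. cinner x u = cinner x v"
  shows "u = v"
proof -
  have "cinner u x = cinner v x" for x
    using assms[of x] by (subst (1 2) cinner_commute) simp
  moreover have "cinner (u - v) x + cinner v x = cinner u x" for x
    using cinner_add_left[of "u - v" v x] by simp
  ultimately have "cinner (u - v) x + cinner v x = cinner v x" for x
    by simp
  then have "cinner (u - v) (u - v) = 0"
    using add_cancel_left_left by blast
  then show ?thesis
    by (simp add: cinner_self)
qed

lemma cadjoint_eqI:
  assumes "bounded_clinear B" and adj: "\<And>x y. cinner (A x) y = cinner x (B y)"
  shows "cadjoint A = B"
  unfolding cadjoint_def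
proof (rule the_equality)
  fix C
  assume C: "bounded_clinear C \<and> (\<forall>x y. cinner (A x) y = cinner x (C y))"
  show "C = B"
  proof
    fix y
    have "cinner x (C y) = cinner x (B y)" for x
      using C adj[of x y] by simp
    then show "C y = B y"
      by (rule cinner_ext)
  qed
qed (use assms in simp)

section \<open>WOT-closed algebras\<close>

text \<open>The weak operator topology: the coarsest topology on the bounded operators for which
  all matrix coefficients are continuous.\<close>

definition wot :: "('a::chilbert_space \<Rightarrow> 'a) topology"
  where "wot = topology_generated_by
    {{A. bounded_clinear A \<and> cinner (A x) y \<in> U} | x y U. open U}"

lemma topspace_wot: "topspace wot = {A. bounded_clinear A}"
  unfolding wot_def topology_generated_by_topspace by blast

definition unital_subalgebra :: "('a::chilbert_space \<Rightarrow> 'a) set \<Rightarrow> bool"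
  where "unital_subalgebra \<A> \<longleftrightarrow>
    \<A> \<subseteq> {A. bounded_clinear A} \<and> id \<in> \<A> \<and>
    (\<forall>A\<in>\<A>. \<forall>B\<in>\<A>. (\<lambda>x. A x + B x) \<in> \<A>) \<and>
    (\<forall>c. \<forall>A\<in>\<A>. (\<lambda>x. c *\<^sub>C A x) \<in> \<A>) \<and>
    (\<forall>A\<in>\<A>. \<forall>B\<in>\<A>. A \<circ> B \<in> \<A>)"

definition wot_algebra_generated_by :: "('a::chilbert_space \<Rightarrow> 'a) set \<Rightarrow> ('a \<Rightarrow> 'a) set"
  where "wot_algebra_generated_by X =
    \<Inter> {\<A>. unital_subalgebra \<A> \<and> closedin wot \<A> \<and> X \<subseteq> \<A>}"

definition self_adjoint :: "('a::chilbert_space \<Rightarrow> 'a) set \<Rightarrow> bool"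
  where "self_adjoint \<A> \<longleftrightarrow> (\<forall>A\<in>\<A>. cadjoint A \<in> \<A>)"

section \<open>Row-isometries\<close>

definition row_isometry :: "nat \<Rightarrow> (nat \<Rightarrow> 'a::chilbert_space \<Rightarrow> 'a) \<Rightarrow> bool"
  where "row_isometry N V \<longleftrightarrow>
    (\<forall>i\<in>{1..N}. bounded_clinear (V i)) \<and>
    (\<forall>i\<in>{1..N}. \<forall>j\<in>{1..N}. cadjoint (V i) \<circ> V j = (if i = j then id else (\<lambda>x. 0)))"

definition free_semigroup_algebra ::
    "nat \<Rightarrow> (nat \<Rightarrow> 'a::chilbert_space \<Rightarrow> 'a) \<Rightarrow> ('a \<Rightarrow> 'a) set"
  where "free_semigroup_algebra N V = wot_algebra_generated_by (V ` {1..N})"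

definition singular :: "nat \<Rightarrow> (nat \<Rightarrow> 'a::chilbert_space \<Rightarrow> 'a) \<Rightarrow> bool"
  where "singular N V \<longleftrightarrow> row_isometry N V \<and> self_adjoint (free_semigroup_algebra N V)"

section \<open>Single vertex 2-graphs and their representations\<close>

text \<open>The semigroup of a single vertex 2-graph is presented by its generators
  $e_1, \ldots, e_m$, $f_1, \ldots, f_n$ and the relations $e_i f_j = f_{j'} e_{i'}$ for
  $\theta(i,j) = (i',j')$; it is represented here by the data $(m, n, \theta)$ of this
  presentation.\<close>

definition single_vertex_2graph :: "nat \<Rightarrow> nat \<Rightarrow> (nat \<times> nat \<Rightarrow> nat \<times> nat) \<Rightarrow> bool"
  where "single_vertex_2graph m n \<theta> \<longleftrightarrow>
    m \<ge> 1 \<and> n \<ge> 1 \<and> (m > 1 \<or> n > 1) \<and> \<theta> permutes ({1..m} \<times> {1..n})"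

definition isometric_representation ::
    "nat \<Rightarrow> nat \<Rightarrow> (nat \<times> nat \<Rightarrow> nat \<times> nat) \<Rightarrow>
      (nat \<Rightarrow> 'a::chilbert_space \<Rightarrow> 'a) \<Rightarrow> (nat \<Rightarrow> 'a \<Rightarrow> 'a) \<Rightarrow> bool"
  where "isometric_representation m n \<theta> S T \<longleftrightarrow>
    row_isometry m S \<and> row_isometry n T \<and>
    (\<forall>i\<in>{1..m}. \<forall>j\<in>{1..n}. \<forall>i' j'. \<theta> (i, j) = (i', j') \<longrightarrow> S i \<circ> T j = T j' \<circ> S i')"

definition two_graph_algebra ::
    "nat \<Rightarrow> nat \<Rightarrow> (nat \<Rightarrow> 'a::chilbert_space \<Rightarrow> 'a) \<Rightarrow> (nat \<Rightarrow> 'a \<Rightarrow> 'a) \<Rightarrow> ('a \<Rightarrow> 'a) set"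
  where "two_graph_algebra m n S T = wot_algebra_generated_by (S ` {1..m} \<union> T ` {1..n})"

end

theory Submission imports Defs begin

text \<open>The adjoint is continuous for the weak operator topology, so for every WOT-closed unital
  algebra \<open>\<A>\<close> the operators \<open>A \<in> \<A>\<close> with \<open>A\<^sup>* \<in> \<A>\<close> again form a
  WOT-closed unital algebra. If \<open>S\<close> and \<open>T\<close> are singular, then the adjoints of all the
  generators lie in \<open>\<SS>\<close>, hence this subalgebra of \<open>\<SS>\<close> contains the generators and is
  all of \<open>\<SS>\<close>. The existence of adjoints is the Riesz representation theorem.\<close>

section \<open>Inner products and the Riesz representation theorem\<close>

lemma cinner_add_right: "cinner x (y + z) = cinner x y + cinner x (z::'a::complex_inner)"
  by (metis cinner_add_left cinner_commute complex_cnj_add)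

lemma cinner_scaleC_right: "cinner x (c *\<^sub>C y) = cnj c * cinner x (y::'a::complex_inner)"
  by (metis cinner_commute cinner_scaleC_left complex_cnj_mult)

lemma cinner_scaleR_left: "cinner (r *\<^sub>R x) y = of_real r * cinner x (y::'a::complex_inner)"
  by (metis cinner_scaleC_left scaleC_of_real)

lemma Re_cinner_commute: "Re (cinner x y) = Re (cinner y (x::'a::complex_inner))"
  by (subst cinner_commute) simp

lemma norm_add_sq:
  "(norm (x + y))\<^sup>2 = (norm x)\<^sup>2 + 2 * Re (cinner x y) + (norm (y::'a::complex_inner))\<^sup>2"
proof -
  have "(norm (x + y))\<^sup>2 = Re (cinner (x + y) (x + y))"
    by (simp only: cinner_self Re_complex_of_real)
  also have "\<dots> = (norm x)\<^sup>2 + Re (cinner x y) + Re (cinner y x) + (norm y)\<^sup>2"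
    by (simp only: cinner_add_left cinner_add_right plus_complex.sel add.assoc)
      (simp only: cinner_self Re_complex_of_real)
  also have "Re (cinner y x) = Re (cinner x y)"
    by (rule Re_cinner_commute)
  finally show ?thesis
    by simp
qed

text \<open>Real Cauchy-Schwarz. The triangle inequality is already available for
  \<open>norm\<close>, so it suffices to square it and compare cross terms.\<close>

lemma Re_cinner_le: "Re (cinner x y) \<le> norm x * norm (y::'a::complex_inner)"
proof -
  have "(norm (x + y))\<^sup>2 \<le> (norm x + norm y)\<^sup>2"
    by (simp add: norm_triangle_ineq power_mono)
  then show ?thesis
    by (simp add: norm_add_sq power2_sum)
qed

lemma abs_Re_cinner_le: "\<bar>Re (cinner x y)\<bar> \<le> norm x * norm (y::'a::complex_inner)"
proof -
  have "- Re (cinner x y) = Re (cinner ((-1) *\<^sub>R x) y)"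
    by (simp only: cinner_scaleR_left) simp
  also have "\<dots> \<le> norm x * norm y"
    using Re_cinner_le[of "(-1) *\<^sub>R x" y] by simp
  finally show ?thesis
    using Re_cinner_le[of x y] by linarith
qed

lemma parallelogram:
  "(norm (x + y))\<^sup>2 + (norm (x - y))\<^sup>2 = 2 * (norm x)\<^sup>2 + 2 * (norm (y::'a::complex_inner))\<^sup>2"
proof -
  \<comment> \<open>Both \<open>x\<close> and \<open>x + y\<close> are sums starting from
    \<open>x - y\<close>; expanding each leaves a single cross term, which is then
    eliminated.\<close>
  have "x - y + y = x" "x + y = x - y + 2 *\<^sub>R y"
    by (simp_all add: scaleR_2)
  then have x: "(norm x)\<^sup>2 = (norm (x - y))\<^sup>2 + 2 * Re (cinner (x - y) y) + (norm y)\<^sup>2"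
    and "(norm (x + y))\<^sup>2 = (norm (x - y))\<^sup>2 + 2 * Re (cinner (x - y) (2 *\<^sub>R y)) + (norm (2 *\<^sub>R y))\<^sup>2"
    using norm_add_sq by metis+
  moreover have "Re (cinner (x - y) (2 *\<^sub>R y)) = 2 * Re (cinner (x - y) y)"
    by (simp add: scaleR_2 cinner_add_right)
  ultimately show ?thesis
    by (simp add: power_mult_distrib)
qed

text \<open>First-order condition at a minimum: near \<open>t = 0\<close> the linear term would
  dominate and take both signs.\<close>

lemma quadratic_nonneg_imp_linear_zero:
  fixes c N :: real
  assumes nonneg: "\<And>t. 0 \<le> 2 * t * c + t\<^sup>2 * N" and "N \<ge> 0"
  shows "c = 0"
proof (rule ccontr)
  assume "c \<noteq> 0"
  \<comment> \<open>Close to the vertex \<open>- c / N\<close> of the parabola; adding 1 keeps the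
    denominator positive when \<open>N = 0\<close>.\<close>
  define t where "t = - c / (N + 1)"
  then have "c = - t * (N + 1)" "t \<noteq> 0"
    using \<open>c \<noteq> 0\<close> \<open>N \<ge> 0\<close> by simp_all
  then have "2 * t * c + t\<^sup>2 * N = - (t\<^sup>2 * (N + 2))"
    by algebra
  also have "\<dots> < 0"
    using \<open>t \<noteq> 0\<close> \<open>N \<ge> 0\<close> by simp
  finally show False
    using nonneg[of t] by simp
qed

text \<open>The representing vector minimises \<open>\<parallel>x\<parallel>\<^sup>2 - 2 g x\<close>; by the parallelogram law every
  minimising sequence is Cauchy.\<close>

lemma riesz_real:
  fixes g :: "'a::chilbert_space \<Rightarrow> real"
  assumes g: "bounded_linear g"
  obtains v where "\<And>x. g x = Re (cinner x v)"
proof -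
  interpret g: bounded_linear g
    by (rule g)
  define \<phi> where "\<phi> x = (norm x)\<^sup>2 - 2 * g x" for x
  define d where "d = (INF x. \<phi> x)"
  obtain K where K: "\<And>x. norm (g x) \<le> norm x * K"
    using g.bounded by blast
  \<comment> \<open>Completing the square: \<open>\<phi> x\<close> is at least
    \<open>(norm x - K)\<^sup>2 - K\<^sup>2\<close>.\<close>
  have "- K\<^sup>2 \<le> \<phi> x" for x
  proof -
    have "g x \<le> norm x * K"
      using K[of x] by simp
    moreover have "0 \<le> (norm x - K)\<^sup>2"
      by simp
    ultimately show ?thesis
      by (simp add: \<phi>_def power2_diff)
  qed
  then have bdd: "bdd_below (range \<phi>)"
    by (intro bdd_belowI2)
  have d_le: "d \<le> \<phi> x" for x
    unfolding d_def by (rule cINF_lower[OF bdd]) simp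
  have "\<exists>x. \<phi> x < d + 1 / real (Suc k)" for k
    using cINF_less_iff[OF _ bdd, of "d + 1 / real (Suc k)"] by (simp flip: d_def)
  then obtain X where X: "\<And>k. \<phi> (X k) < d + 1 / real (Suc k)"
    by metis
  \<comment> \<open>The value of \<open>\<phi>\<close> at the midpoint of \<open>x\<close> and
    \<open>y\<close> is at least \<open>d\<close>; the parallelogram law turns this into a bound on
    the distance.\<close>
  have midpoint: "(norm (x - y))\<^sup>2 \<le> 2 * (\<phi> x + \<phi> y - 2 * d)" for x y
  proof -
    have "\<phi> ((1/2) *\<^sub>R (x + y)) = (norm (x + y))\<^sup>2 / 4 - (g x + g y)"
      by (simp only: \<phi>_def g.scaleR g.add norm_scaleR power_mult_distrib)
        (simp add: power2_eq_square field_simps)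
    with d_le[of "(1/2) *\<^sub>R (x + y)"] parallelogram[of x y] show ?thesis
      by (simp add: \<phi>_def)
  qed
  have "Cauchy X"
  proof (rule CauchyI)
    fix e :: real
    assume "0 < e"
    \<comment> \<open>Two values of \<open>\<phi>\<close> within \<open>e\<^sup>2 / 4\<close> of
      \<open>d\<close> make the right-hand side of \<open>midpoint\<close> smaller than
      \<open>e\<^sup>2\<close>.\<close>
    then obtain M where M: "1 / real (Suc M) < e\<^sup>2 / 4"
      using reals_Archimedean[of "e\<^sup>2 / 4"] by (auto simp: inverse_eq_divide)
    have near: "\<phi> (X k) < d + e\<^sup>2 / 4" if "M \<le> k" for k
    proof -
      have "1 / real (Suc k) \<le> 1 / real (Suc M)"
        using that by (simp add: frac_le)
      then show ?thesis
        using X[of k] M by argo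
    qed
    have "norm (X k - X l) < e" if "M \<le> k" "M \<le> l" for k l
    proof -
      have "(norm (X k - X l))\<^sup>2 < e\<^sup>2"
        using midpoint[of "X k" "X l"] near[OF that(1)] near[OF that(2)] by argo
      then show ?thesis
        using \<open>0 < e\<close> by (simp add: power2_less_imp_less)
    qed
    then show "\<exists>M. \<forall>k\<ge>M. \<forall>l\<ge>M. norm (X k - X l) < e"
      by blast
  qed
  then obtain v where v: "X \<longlonglongrightarrow> v"
    using Cauchy_convergent convergent_def by blast
  then have "(\<lambda>k. \<phi> (X k)) \<longlonglongrightarrow> \<phi> v"
    unfolding \<phi>_def by (intro tendsto_intros g.tendsto)
  moreover have "(\<lambda>k. d + 1 / real (Suc k)) \<longlonglongrightarrow> d + 0"
    by (intro tendsto_intros LIMSEQ_Suc lim_1_over_n)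
  ultimately have "\<phi> v \<le> d"
    using X by (intro LIMSEQ_le[of "\<lambda>k. \<phi> (X k)" "\<phi> v"]) (auto intro: less_imp_le)
  then have min: "\<phi> v \<le> \<phi> x" for x
    using d_le order_trans by blast
  have "g x = Re (cinner x v)" for x
  proof -
    \<comment> \<open>This is the increment of \<open>\<phi>\<close> from the minimiser
      \<open>v\<close> to \<open>v + t x\<close>.\<close>
    have "0 \<le> 2 * t * (Re (cinner x v) - g x) + t\<^sup>2 * (norm x)\<^sup>2" for t
    proof -
      have "\<phi> (t *\<^sub>R x + v) = \<phi> v + (2 * t * (Re (cinner x v) - g x) + t\<^sup>2 * (norm x)\<^sup>2)"
        by (simp add: \<phi>_def norm_add_sq cinner_scaleR_left g.add g.scaleR power_mult_distrib
            Re_cinner_commute[of v "t *\<^sub>R x"] algebra_simps)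
      with min[of "t *\<^sub>R x + v"] show ?thesis
        by linarith
    qed
    then show ?thesis
      using quadratic_nonneg_imp_linear_zero[of "Re (cinner x v) - g x" "(norm x)\<^sup>2"] by simp
  qed
  then show thesis
    by (rule that)
qed

section \<open>Adjoints\<close>

lemma bounded_clinear_linear: "bounded_clinear A \<Longrightarrow> bounded_linear A"
  by (simp add: bounded_clinear_def)

text \<open>For fixed \<open>y\<close>, real Riesz represents the real part of
  \<open>cinner (A x) y\<close>; complex linearity recovers the imaginary part, and the representing
  vectors define \<open>B\<close>.\<close>

lemma adjoint_exists:
  fixes A :: "'a::chilbert_space \<Rightarrow> 'a"
  assumes A: "bounded_clinear A"
  obtains B where "bounded_clinear B" "\<And>x y. cinner (A x) y = cinner x (B y)"
proof -
  interpret A: bounded_linear A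
    using A by (rule bounded_clinear_linear)
  have A_scaleC: "A (c *\<^sub>C x) = c *\<^sub>C A x" for c x
    using A by (simp add: bounded_clinear_def)
  obtain K where K: "0 < K" "\<And>x. norm (A x) \<le> norm x * K"
    using A.pos_bounded by blast
  have "\<exists>v. \<forall>x. cinner (A x) y = cinner x v" for y
  proof -
    have "bounded_linear (\<lambda>x. Re (cinner (A x) y))"
    proof (rule bounded_linear_intro[where K = "K * norm y"])
      show "norm (Re (cinner (A x) y)) \<le> norm x * (K * norm y)" for x
        using abs_Re_cinner_le[of "A x" y] mult_right_mono[OF K(2)[of x] norm_ge_zero[of y]]
        by (simp add: mult.assoc)
    qed (simp_all add: A.add A.scaleR cinner_add_left cinner_scaleR_left)
    then obtain v where v: "\<And>x. Re (cinner (A x) y) = Re (cinner x v)"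
      using riesz_real by blast
    \<comment> \<open>The real part at \<open>\<i> *\<^sub>C x\<close> is minus the imaginary part
      at \<open>x\<close>.\<close>
    have "Im (cinner (A x) y) = Im (cinner x v)" for x
      using v[of "\<i> *\<^sub>C x"] by (simp add: A_scaleC cinner_scaleC_left)
    with v show ?thesis
      by (auto intro: complex_eqI)
  qed
  then obtain B where B: "\<And>x y. cinner (A x) y = cinner x (B y)"
    by metis
  have B_add: "B (y + z) = B y + B z" for y z
    by (rule cinner_ext) (simp add: cinner_add_right flip: B)
  have B_scaleC: "B (c *\<^sub>C y) = c *\<^sub>C B y" for c y
    by (rule cinner_ext) (simp add: cinner_scaleC_right flip: B)
  \<comment> \<open>Test the adjoint identity at \<open>x = B y\<close>, then cancel one factor
    \<open>norm (B y)\<close>.\<close>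
  have B_bound: "norm (B y) \<le> norm y * K" for y
  proof (cases "B y = 0")
    case False
    have "(norm (B y))\<^sup>2 = Re (cinner (A (B y)) y)"
      by (simp only: B cinner_self Re_complex_of_real)
    also have "\<dots> \<le> norm (A (B y)) * norm y"
      by (rule Re_cinner_le)
    also have "\<dots> \<le> norm (B y) * K * norm y"
      by (intro mult_right_mono K) simp
    finally show ?thesis
      using False by (simp add: power2_eq_square ac_simps)
  qed (use K in simp)
  have "bounded_linear B"
    using B_add B_scaleC B_bound
    by (intro bounded_linear_intro[where K = K]) (simp_all flip: scaleC_of_real)
  then have "bounded_clinear B"
    using B_scaleC by (simp add: bounded_clinear_def)
  then show thesis
    using B by (rule that)
qed

text \<open>The description defining \<open>cadjoint\<close> is met: existence is
  \<open>adjoint_exists\<close>, uniqueness is \<open>cadjoint_eqI\<close>.\<close>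

lemma
  fixes A :: "'a::chilbert_space \<Rightarrow> 'a"
  assumes "bounded_clinear A"
  shows bounded_clinear_cadjoint: "bounded_clinear (cadjoint A)"
    and cinner_cadjoint: "cinner (A x) y = cinner x (cadjoint A y)"
  using adjoint_exists[OF assms] cadjoint_eqI[of _ A] by metis+

section \<open>Adjoints and the algebra operations\<close>

lemma cadjoint_id: "cadjoint id = (id :: 'a::chilbert_space \<Rightarrow> 'a)"
  by (rule cadjoint_eqI) (simp_all add: bounded_clinear_def id_def)

lemma bounded_clinear_add:
  "bounded_clinear A \<Longrightarrow> bounded_clinear B \<Longrightarrow> bounded_clinear (\<lambda>x. A x + B x)"
  by (simp add: bounded_clinear_def bounded_linear_add scaleC_add_right)

lemma norm_scaleC: "norm (c *\<^sub>C x) = cmod c * norm (x::'a::complex_inner)"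
proof (rule power2_eq_imp_eq)
  have "complex_of_real ((norm (c *\<^sub>C x))\<^sup>2) = c * cnj c * complex_of_real ((norm x)\<^sup>2)"
    by (simp only: cinner_scaleC_left cinner_scaleC_right flip: cinner_self) simp
  also have "\<dots> = complex_of_real ((cmod c * norm x)\<^sup>2)"
    by (simp only: complex_norm_square[symmetric] power_mult_distrib of_real_mult)
  finally show "(norm (c *\<^sub>C x))\<^sup>2 = (cmod c * norm x)\<^sup>2"
    by (simp only: of_real_eq_iff)
qed simp_all

lemma bounded_clinear_scaleC:
  assumes "bounded_clinear (A :: 'a::complex_inner \<Rightarrow> 'a)"
  shows "bounded_clinear (\<lambda>x. c *\<^sub>C A x)"
proof -
  have "bounded_linear (\<lambda>x::'a. c *\<^sub>C x)"
  proof (rule bounded_linear_intro[where K = "cmod c"])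
    show "c *\<^sub>C r *\<^sub>R x = r *\<^sub>R c *\<^sub>C x" for r and x :: 'a
      by (simp add: scaleC_scaleC mult.commute flip: scaleC_of_real)
  qed (simp_all add: scaleC_add_right norm_scaleC mult.commute)
  from bounded_linear_compose[OF this bounded_clinear_linear[OF assms]] assms show ?thesis
    by (simp add: bounded_clinear_def scaleC_scaleC mult.commute)
qed

lemma bounded_clinear_comp:
  "bounded_clinear A \<Longrightarrow> bounded_clinear B \<Longrightarrow> bounded_clinear (A \<circ> B)"
  by (simp add: bounded_clinear_def bounded_linear_compose comp_def)

lemma cadjoint_add:
  assumes "bounded_clinear A" "bounded_clinear B"
  shows "cadjoint (\<lambda>x. A x + B x) = (\<lambda>x. cadjoint A x + cadjoint B x)"
  by (rule cadjoint_eqI)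
    (simp_all add: assms bounded_clinear_add bounded_clinear_cadjoint cinner_add_left
      cinner_add_right cinner_cadjoint)

lemma cadjoint_scaleC:
  assumes "bounded_clinear A"
  shows "cadjoint (\<lambda>x. c *\<^sub>C A x) = (\<lambda>x. cnj c *\<^sub>C cadjoint A x)"
  by (rule cadjoint_eqI)
    (simp_all add: assms bounded_clinear_scaleC bounded_clinear_cadjoint cinner_scaleC_left
      cinner_scaleC_right cinner_cadjoint)

lemma cadjoint_comp:
  assumes "bounded_clinear A" "bounded_clinear B"
  shows "cadjoint (A \<circ> B) = cadjoint B \<circ> cadjoint A"
  by (rule cadjoint_eqI)
    (simp_all add: assms bounded_clinear_comp bounded_clinear_cadjoint cinner_cadjoint)

section \<open>Self-adjointness of generated algebras\<close>

text \<open>Taking adjoints swaps the two vectors of a matrix coefficient and conjugates its value,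
  so preimages of subbasic sets are subbasic.\<close>

lemma continuous_map_cadjoint:
  "continuous_map wot (wot :: ('a::chilbert_space \<Rightarrow> 'a) topology) cadjoint"
  unfolding wot_def[where 'a = 'a]
proof (rule continuous_on_generated_topo, fold wot_def)
  fix W :: "('a \<Rightarrow> 'a) set"
  assume "W \<in> {{A. bounded_clinear A \<and> cinner (A x) y \<in> U} | x y U. open U}"
  then obtain x y U where W: "W = {A. bounded_clinear A \<and> cinner (A x) y \<in> U}" and "open U"
    by blast
  have "cinner (cadjoint A x) y = cnj (cinner (A y) x)" if "bounded_clinear A" for A
    by (metis cinner_cadjoint[OF that] cinner_commute)
  then have "cadjoint -` W \<inter> topspace wot
      = {A. bounded_clinear A \<and> cinner (A y) x \<in> cnj -` U}"
    by (auto simp: W topspace_wot bounded_clinear_cadjoint)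
  moreover have "open (cnj -` U)"
    using \<open>open U\<close> by (intro open_vimage continuous_intros)
  ultimately show "openin wot (cadjoint -` W \<inter> topspace wot)"
    unfolding wot_def by (intro topology_generated_by_Basis) blast
next
  show "cadjoint ` topspace wot
      \<subseteq> \<Union> {{A :: 'a \<Rightarrow> 'a. bounded_clinear A \<and> cinner (A x) y \<in> U} | x y U. open U}"
    using bounded_clinear_cadjoint topspace_wot unfolding wot_def topology_generated_by_topspace
    by blast
qed

text \<open>Adjoints conjugate scalars and reverse products; \<open>\<A>\<close> admits all scalars
  and products in either order.\<close>

lemma unital_subalgebra_self_adjoint_part:
  assumes "unital_subalgebra \<A>"
  shows "unital_subalgebra {A \<in> \<A>. cadjoint A \<in> \<A>}"
proof -
  have bounded: "bounded_clinear A" if "A \<in> \<A>" for A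
    using assms that by (auto simp: unital_subalgebra_def)
  show ?thesis
    using assms
    by (auto simp: unital_subalgebra_def bounded cadjoint_id cadjoint_add cadjoint_scaleC
        cadjoint_comp)
qed

lemma closedin_wot_self_adjoint_part:
  assumes "closedin wot \<A>"
  shows "closedin wot {A \<in> \<A>. cadjoint A \<in> \<A>}"
proof -
  have "closedin wot (\<A> \<inter> {A \<in> topspace wot. cadjoint A \<in> \<A>})"
    using assms closedin_continuous_map_preimage[OF continuous_map_cadjoint assms]
    by (rule closedin_Int)
  also have "\<A> \<inter> {A \<in> topspace wot. cadjoint A \<in> \<A>} = {A \<in> \<A>. cadjoint A \<in> \<A>}"
    using closedin_subset[OF assms] by blast
  finally show ?thesis .
qed

lemma self_adjoint_wot_algebra_generated_by:
  assumes X: "\<And>A. A \<in> X \<Longrightarrow> cadjoint A \<in> wot_algebra_generated_by X"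
  shows "self_adjoint (wot_algebra_generated_by X)"
  unfolding self_adjoint_def
proof
  fix A
  assume A: "A \<in> wot_algebra_generated_by X"
  \<comment> \<open>The generated algebra is an intersection, so each member \<open>\<A>\<close> is
    treated separately: its self-adjoint part is again a member, hence contains
    \<open>A\<close>.\<close>
  have "cadjoint A \<in> \<A>" if \<A>: "unital_subalgebra \<A>" "closedin wot \<A>" "X \<subseteq> \<A>" for \<A>
  proof -
    have "X \<subseteq> {A \<in> \<A>. cadjoint A \<in> \<A>}"
      using X \<A> unfolding wot_algebra_generated_by_def by blast
    with A show ?thesis
      using unital_subalgebra_self_adjoint_part[OF \<A>(1)] closedin_wot_self_adjoint_part[OF \<A>(2)]
      unfolding wot_algebra_generated_by_def by blast
  qed
  then show "cadjoint A \<in> wot_algebra_generated_by X"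
    unfolding wot_algebra_generated_by_def by blast
qed

lemma wot_algebra_generated_by_superset: "X \<subseteq> wot_algebra_generated_by X"
  unfolding wot_algebra_generated_by_def by blast

lemma wot_algebra_generated_by_mono:
  "X \<subseteq> Y \<Longrightarrow> wot_algebra_generated_by X \<subseteq> wot_algebra_generated_by Y"
  unfolding wot_algebra_generated_by_def by blast

lemma singular_cadjoint_mem:
  assumes "singular N V" "A \<in> V ` {1..N}"
  shows "cadjoint A \<in> wot_algebra_generated_by (V ` {1..N})"
  using assms wot_algebra_generated_by_superset
  unfolding singular_def self_adjoint_def free_semigroup_algebra_def by blast

theorem proposition5p3:
  fixes m n :: nat
    and \<theta> :: "nat \<times> nat \<Rightarrow> nat \<times> nat"
    and S T :: "nat \<Rightarrow> 'a::chilbert_space \<Rightarrow> 'a"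
  assumes "single_vertex_2graph m n \<theta>"
    and "isometric_representation m n \<theta> S T"
    and "singular m S"
    and "singular n T"
  shows "self_adjoint (two_graph_algebra m n S T)"
  unfolding two_graph_algebra_def
proof (rule self_adjoint_wot_algebra_generated_by)
  fix A
  assume "A \<in> S ` {1..m} \<union> T ` {1..n}"
  \<comment> \<open>Singularity places the adjoint of a generator in the algebra of its own family;
    monotonicity carries it into the joint algebra.\<close>
  then have "cadjoint A \<in> wot_algebra_generated_by (S ` {1..m}) \<union> wot_algebra_generated_by (T ` {1..n})"
    using singular_cadjoint_mem[OF assms(3)] singular_cadjoint_mem[OF assms(4)] by blast
  then show "cadjoint A \<in> wot_algebra_generated_by (S ` {1..m} \<union> T ` {1..n})"
    using wot_algebra_generated_by_mono[of "S ` {1..m}" "S ` {1..m} \<union> T ` {1..n}"]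
      wot_algebra_generated_by_mono[of "T ` {1..n}" "S ` {1..m} \<union> T ` {1..n}"] by blast
qed

end
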